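(* Let $U\subseteq\mathbb{R}^2$ be a nonempty open connected set with coordinates $(u,v)$, and let $i:U\to\mathbb{R}^3$ be a smooth immersion. Suppose that the coefficients of the first fundamental form of $i$ are $g_{ij}(u,v)=E(u,v)\,\delta_{ij}$, where $E:U\to\mathbb{R}$ is strictly positive and harmonic, and that the coefficients of the second fundamental form of $i$ are $l_{ij}(u,v)=e(u,v)\,\delta_{ij}$ for some function $e:U\to\mathbb{R}$. Then $i(U)$ is contained in an affine plane of $\mathbb{R}^3$. Conversely, every affine plane of $\mathbb{R}^3$ is the image of a smooth immersion $i:\mathbb{R}^2\to\mathbb{R}^3$ whose first and second fundamental forms have coefficients $g_{ij}=E\,\delta_{ij}$ and $l_{ij}=e\,\delta_{ij}$, with $E$ strictly positive and harmonic on $\mathbb{R}^2$ and $e:\mathbb{R}^2\to\mathbb{R}$ a function.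
   Context: For a smooth immersion $i:U\to\mathbb{R}^3$ with coordinates $(x_1,x_2)=(u,v)$ on $U$, the first fundamental form has coefficients $g_{ij}=\langle \partial_{x_i} i,\partial_{x_j} i\rangle$, and the second fundamental form has coefficients $l_{ij}=\langle \partial_{x_i}\partial_{x_j} i,\,N\rangle$, where $N=\dfrac{\partial_u i\times\partial_v i}{|\partial_u i\times\partial_v i|}$ is the unit normal. $\delta_{ij}$ is the Kronecker delta. A function $E$ on $U$ is harmonic if $\partial_u^2E+\partial_v^2E=0$ on $U$. *)

theory Defs
  imports "HOL-Analysis.Analysis"
begin

text \<open>
  The predicates below are meant for open sets \<open>S\<close>: all derivatives are derivatives
  at a point of the ambient space, so for an open \<open>S\<close> they do not depend on the values
  of the (total) function outside \<open>S\<close>.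
\<close>

primrec C_k_on :: "nat \<Rightarrow> 'a::real_normed_vector set \<Rightarrow> ('a \<Rightarrow> 'b::real_normed_vector) \<Rightarrow> bool" where
  "C_k_on 0 S f \<longleftrightarrow> continuous_on S f"
| "C_k_on (Suc k) S f \<longleftrightarrow>
     (\<forall>x\<in>S. f differentiable (at x)) \<and>
     (\<forall>v. C_k_on k S (\<lambda>x. frechet_derivative f (at x) v))"

definition smooth_on :: "'a::real_normed_vector set \<Rightarrow> ('a \<Rightarrow> 'b::real_normed_vector) \<Rightarrow> bool" where
  "smooth_on S f \<longleftrightarrow> (\<forall>k. C_k_on k S f)"

definition smooth_immersion_on ::
  "'a::real_normed_vector set \<Rightarrow> ('a \<Rightarrow> 'b::real_normed_vector) \<Rightarrow> bool" where
  "smooth_immersion_on S f \<longleftrightarrow>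
     smooth_on S f \<and> (\<forall>x\<in>S. inj (frechet_derivative f (at x)))"

definition partial_deriv :: "'n \<Rightarrow> (real ^ 'n \<Rightarrow> 'b::real_normed_vector) \<Rightarrow> real ^ 'n \<Rightarrow> 'b" where
  "partial_deriv k f x = vector_derivative (\<lambda>t. f (x + t *\<^sub>R axis k 1)) (at 0)"

text \<open>
  The requirement of two continuous derivatives is the usual convention for harmonic functions;
  it guarantees that the second partial derivatives in the Laplace equation exist.
\<close>

definition harmonic_on :: "(real ^ 2) set \<Rightarrow> (real ^ 2 \<Rightarrow> real) \<Rightarrow> bool" where
  "harmonic_on S E \<longleftrightarrow>
     C_k_on 2 S E \<and>
     (\<forall>x\<in>S. partial_deriv 1 (partial_deriv 1 E) x + partial_deriv 2 (partial_deriv 2 E) x = 0)"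

definition unit_normal :: "(real ^ 2 \<Rightarrow> real ^ 3) \<Rightarrow> real ^ 2 \<Rightarrow> real ^ 3" where
  "unit_normal f x =
     cross3 (partial_deriv 1 f x) (partial_deriv 2 f x) /\<^sub>R
       norm (cross3 (partial_deriv 1 f x) (partial_deriv 2 f x))"

definition first_ff :: "(real ^ 2 \<Rightarrow> real ^ 3) \<Rightarrow> real ^ 2 \<Rightarrow> 2 \<Rightarrow> 2 \<Rightarrow> real" where
  "first_ff f x j k = partial_deriv j f x \<bullet> partial_deriv k f x"

definition second_ff :: "(real ^ 2 \<Rightarrow> real ^ 3) \<Rightarrow> real ^ 2 \<Rightarrow> 2 \<Rightarrow> 2 \<Rightarrow> real" where
  "second_ff f x j k = partial_deriv j (partial_deriv k f) x \<bullet> unit_normal f x"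

definition kronecker :: "'n \<Rightarrow> 'n \<Rightarrow> real" where
  "kronecker j k = (if j = k then 1 else 0)"

definition affine_plane :: "(real ^ 3) set \<Rightarrow> bool" where
  "affine_plane P \<longleftrightarrow> affine P \<and> aff_dim P = 2"

end

theory Submission
  imports Defs
begin

text \<open>
  Let \<open>a = i_u\<close>, \<open>b = i_v\<close> and let \<open>N\<close> be the unit normal. Since both fundamental forms are
  multiples of the identity, every point is umbilic with principal curvature \<open>H = e / E\<close>, and the derivatives
  of the normal are \<open>N_u = - H a\<close> and \<open>N_v = - H b\<close> (\<open>weingarten\<close>). Comparing \<open>N_uv\<close> with
  \<open>N_vu\<close> shows that \<open>H\<close> is constant on the connected domain (\<open>H_constant\<close>): the surface is part of a plane
  or of a sphere. Harmonicity of \<open>E\<close> excludes the sphere. It simplifies the Gauss equation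
  to \<open>E_u\<^sup>2 + E_v\<^sup>2 = 2 H\<^sup>2 E\<^sup>3\<close> (\<open>gradient_eq\<close>), and a positive harmonic function
  whose squared gradient is a constant multiple of its cube has vanishing gradient, so the constant
  is zero (\<open>harmonic_cubic_gradient_imp_zero\<close>). Hence \<open>H = 0\<close>, the normal is constant, and the
  image lies in a plane orthogonal to it (\<open>planar\<close>).

  Several steps compare mixed partial derivatives. They rest on the symmetry of second
  derivatives in the form that needs only differentiability of the first derivatives at the point
  (\<open>mixed_derivatives_commute\<close>).

  Conversely, an orthonormal basis of the direction space of a plane parametrizes the plane with
  \<open>E = 1\<close> and \<open>e = 0\<close> (\<open>orthonormal_param_flat\<close>).
\<close>

section \<open>Symmetry of second derivatives\<close>

text \<open>
  The mean value theorem in direction \<open>a\<close> turns the second difference into \<open>h\<close> times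
  a first difference of the derivative in direction \<open>a\<close>, and differentiability of that derivative
  at the single point \<open>x\<close> evaluates it up to \<open>o(h)\<close>. The difference quotient is symmetric
  in \<open>a\<close> and \<open>b\<close>, which is what makes its limit useful.
\<close>
lemma second_difference_tendsto:
  fixes f :: "'a::real_normed_vector \<Rightarrow> real"
  assumes "open U" "x \<in> U"
    and f': "\<And>y. y \<in> U \<Longrightarrow> (f has_derivative f' y) (at y)"
    and g': "((\<lambda>y. f' y a) has_derivative g') (at x)"
  shows "((\<lambda>h. (f (x + h *\<^sub>R a + h *\<^sub>R b) - f (x + h *\<^sub>R a) - f (x + h *\<^sub>R b) + f x) / h\<^sup>2)
            \<longlongrightarrow> g' b) (at_right 0)"
proof -
  \<comment> \<open>\<open>h * M\<close> bounds the sum of the distances from \<open>x\<close> to the two points compared below;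
      the summand 1 keeps \<open>M\<close> positive when both directions vanish.\<close>
  define M where "M = 2 * norm a + norm b + 1"
  have M: "M > 0" by (simp add: M_def add_nonneg_pos)
  obtain r where r: "r > 0" "ball x r \<subseteq> U"
    using assms(1,2) openE by blast
  have lin: "linear g'" using g' has_derivative_linear by blast
  show ?thesis
    unfolding tendsto_iff
  proof (intro allI impI)
    fix \<epsilon> :: real assume "\<epsilon> > 0"
    define \<eta> where "\<eta> = \<epsilon> / (2 * M)"
    have \<eta>: "\<eta> > 0" using \<open>\<epsilon> > 0\<close> M by (simp add: \<eta>_def)
    obtain d where d: "d > 0"
      and lin_approx: "\<And>y. norm (y - x) < d \<Longrightarrow>
             norm (f' y a - f' x a - g' (y - x)) \<le> \<eta> * norm (y - x)"
      using g' \<eta> unfolding has_derivative_at_alt by blast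
    have "eventually (\<lambda>h. h \<in> {0<..<min r d / M}) (at_right (0::real))"
      using r d M by (intro eventually_at_right_real) simp
    then show "\<forall>\<^sub>F h in at_right 0.
        dist ((f (x + h *\<^sub>R a + h *\<^sub>R b) - f (x + h *\<^sub>R a) - f (x + h *\<^sub>R b) + f x) / h\<^sup>2) (g' b) < \<epsilon>"
    proof eventually_elim
      fix h assume "h \<in> {0<..<min r d / M}"
      then have h: "h > 0" "h * M < r" "h * M < d"
        using M by (auto simp: field_simps)
      have small: "norm (t *\<^sub>R a + s *\<^sub>R b) \<le> h * (norm a + norm b)"
        if "0 \<le> t" "t \<le> h" "0 \<le> s" "s \<le> h" for t s
      proof -
        have "norm (t *\<^sub>R a + s *\<^sub>R b) \<le> t * norm a + s * norm b"
          using norm_triangle_ineq[of "t *\<^sub>R a" "s *\<^sub>R b"] that by simp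
        also have "\<dots> \<le> h * norm a + h * norm b"
          using that by (intro add_mono mult_right_mono) auto
        finally show ?thesis by (simp add: distrib_left)
      qed
      have le_M: "h * (norm a + norm b) < h * M"
        using h by (simp add: M_def add_nonneg_pos)
      have inU: "x + t *\<^sub>R a + s *\<^sub>R b \<in> U" if "0 \<le> t" "t \<le> h" "0 \<le> s" "s \<le> h" for t s
      proof -
        have "dist x (x + t *\<^sub>R a + s *\<^sub>R b) = norm (t *\<^sub>R a + s *\<^sub>R b)"
          by (metis add.assoc add_diff_cancel_left' dist_commute dist_norm)
        then have "dist x (x + t *\<^sub>R a + s *\<^sub>R b) < r"
          using small[OF that] le_M h(2) by linarith
        then show ?thesis
          using r(2) by auto
      qed
      define F where "F t = f (x + t *\<^sub>R a + h *\<^sub>R b) - f (x + t *\<^sub>R a)" for t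
      have F': "(F has_derivative (\<lambda>s. s * (f' (x + t *\<^sub>R a + h *\<^sub>R b) a - f' (x + t *\<^sub>R a) a))) (at t)"
        if t: "0 \<le> t" "t \<le> h" for t
      proof -
        have in1: "x + t *\<^sub>R a + h *\<^sub>R b \<in> U" using inU[of t h] t h by simp
        have in2: "x + t *\<^sub>R a \<in> U" using inU[of t 0] t h by simp
        note lin1 = has_derivative_linear[OF f'[OF in1]]
        note lin2 = has_derivative_linear[OF f'[OF in2]]
        have 1: "((\<lambda>t. f (x + t *\<^sub>R a + h *\<^sub>R b)) has_derivative
              (\<lambda>s. f' (x + t *\<^sub>R a + h *\<^sub>R b) (s *\<^sub>R a))) (at t)"
          by (rule has_derivative_compose[where f = "\<lambda>t. x + t *\<^sub>R a + h *\<^sub>R b" and g = f,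
                OF _ f'[OF in1]])
             (auto intro!: derivative_eq_intros)
        have 2: "((\<lambda>t. f (x + t *\<^sub>R a)) has_derivative (\<lambda>s. f' (x + t *\<^sub>R a) (s *\<^sub>R a))) (at t)"
          by (rule has_derivative_compose[where f = "\<lambda>t. x + t *\<^sub>R a" and g = f,
                OF _ f'[OF in2]])
             (auto intro!: derivative_eq_intros)
        show ?thesis
          unfolding F_def
          by (rule has_derivative_eq_rhs[OF has_derivative_diff[OF 1 2]])
             (simp only: linear_cmul[OF lin1] linear_cmul[OF lin2] real_scaleR_def right_diff_distrib)
      qed
      obtain t where t: "0 < t" "t < h"
        and mvt: "F h - F 0 = (h - 0) * (f' (x + t *\<^sub>R a + h *\<^sub>R b) a - f' (x + t *\<^sub>R a) a)"
      proof -
        have "\<exists>t\<in>{0<..<h}. F h - F 0 =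
              (h - 0) * (f' (x + t *\<^sub>R a + h *\<^sub>R b) a - f' (x + t *\<^sub>R a) a)"
          by (rule mvt_simple[OF h(1), where f = F and
                f' = "\<lambda>t s. s * (f' (x + t *\<^sub>R a + h *\<^sub>R b) a - f' (x + t *\<^sub>R a) a)"])
             (rule has_derivative_at_withinI[OF F'])
        then show ?thesis using that by auto
      qed
      define y where "y = x + t *\<^sub>R a + h *\<^sub>R b"
      define z where "z = x + t *\<^sub>R a"
      have y: "norm (y - x) \<le> h * (norm a + norm b)"
        using small[of t h] t by (simp add: y_def)
      have z: "norm (z - x) \<le> h * norm a"
        using t by (simp add: z_def mult_right_mono)
      have zM: "h * norm a < h * M"
        using h by (simp add: M_def add_nonneg_pos)
      have gb: "g' (y - x) - g' (z - x) = h * g' b"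
        by (simp add: y_def z_def linear_add[OF lin] linear_cmul[OF lin])
      have Y: "\<bar>f' y a - f' x a - g' (y - x)\<bar> \<le> \<eta> * (h * (norm a + norm b))"
      proof -
        have "norm (y - x) < d" using y le_M h(3) by linarith
        then have "\<bar>f' y a - f' x a - g' (y - x)\<bar> \<le> \<eta> * norm (y - x)"
          using lin_approx by simp
        also have "\<dots> \<le> \<eta> * (h * (norm a + norm b))"
          using y \<eta> by (intro mult_left_mono) auto
        finally show ?thesis .
      qed
      have Z: "\<bar>f' z a - f' x a - g' (z - x)\<bar> \<le> \<eta> * (h * norm a)"
      proof -
        have "norm (z - x) < d" using z zM h(3) by linarith
        then have "\<bar>f' z a - f' x a - g' (z - x)\<bar> \<le> \<eta> * norm (z - x)"
          using lin_approx by simp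
        also have "\<dots> \<le> \<eta> * (h * norm a)"
          using z \<eta> by (intro mult_left_mono) auto
        finally show ?thesis .
      qed
      have "\<bar>f' y a - f' z a - h * g' b\<bar> \<le> \<eta> * (h * (norm a + norm b)) + \<eta> * (h * norm a)"
        using Y Z gb by linarith
      also have "\<dots> \<le> \<eta> * (h * M)"
        using \<eta> h by (simp add: M_def algebra_simps)
      also have "\<dots> = h * (\<epsilon> / 2)"
        using M by (simp add: \<eta>_def)
      finally have fin: "\<bar>f' y a - f' z a - h * g' b\<bar> \<le> h * (\<epsilon> / 2)" .
      have "(f (x + h *\<^sub>R a + h *\<^sub>R b) - f (x + h *\<^sub>R a) - f (x + h *\<^sub>R b) + f x) / h\<^sup>2 - g' b
          = (F h - F 0) / h\<^sup>2 - g' b"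
        by (simp add: F_def)
      also have "\<dots> = (f' y a - f' z a - h * g' b) / h"
        using h by (simp add: mvt y_def z_def field_simps power2_eq_square)
      finally have "dist ((f (x + h *\<^sub>R a + h *\<^sub>R b) - f (x + h *\<^sub>R a) - f (x + h *\<^sub>R b) + f x) / h\<^sup>2) (g' b)
          = \<bar>f' y a - f' z a - h * g' b\<bar> / h"
        using h by (simp add: dist_real_def)
      also have "\<dots> \<le> \<epsilon> / 2"
        using fin h by (simp add: field_simps)
      finally show "dist ((f (x + h *\<^sub>R a + h *\<^sub>R b) - f (x + h *\<^sub>R a) - f (x + h *\<^sub>R b) + f x) / h\<^sup>2) (g' b) < \<epsilon>"
        using \<open>\<epsilon> > 0\<close> by linarith
    qed
  qed
qed

text \<open>
  Young's form of the symmetry of second derivatives, which asks for differentiability of the two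
  first derivatives at the point only, and so spares every application from tracking continuity. Both sides are
  limits of the same symmetric difference quotient; testing against \<open>w\<close> reduces to real values.
\<close>
lemma mixed_derivatives_commute:
  fixes f :: "'a::real_normed_vector \<Rightarrow> 'b::real_inner"
  assumes "open U" "x \<in> U"
    and f': "\<And>y. y \<in> U \<Longrightarrow> (f has_derivative f' y) (at y)"
    and A: "((\<lambda>y. f' y a) has_derivative A) (at x)"
    and B: "((\<lambda>y. f' y b) has_derivative B) (at x)"
  shows "A b = B a"
proof -
  have "A b \<bullet> w = B a \<bullet> w" for w
  proof -
    have fw: "((\<lambda>y. f y \<bullet> w) has_derivative (\<lambda>v. f' y v \<bullet> w)) (at y)" if "y \<in> U" for y
      using f'[OF that] by (rule has_derivative_inner_left)
    let ?Q = "\<lambda>a b h. (f (x + h *\<^sub>R a + h *\<^sub>R b) \<bullet> w - f (x + h *\<^sub>R a) \<bullet> w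
                 - f (x + h *\<^sub>R b) \<bullet> w + f x \<bullet> w) / h\<^sup>2"
    have 1: "(?Q a b \<longlongrightarrow> A b \<bullet> w) (at_right 0)"
      by (rule second_difference_tendsto[OF assms(1,2) fw has_derivative_inner_left[OF A]])
    have "(?Q b a \<longlongrightarrow> B a \<bullet> w) (at_right 0)"
      by (rule second_difference_tendsto[OF assms(1,2) fw has_derivative_inner_left[OF B]])
    moreover have "?Q b a = ?Q a b"
      by (simp add: fun_eq_iff algebra_simps)
    ultimately have 2: "(?Q a b \<longlongrightarrow> B a \<bullet> w) (at_right 0)"
      by (simp only:)
    show ?thesis
      by (rule tendsto_unique[OF trivial_limit_at_right_real 1 2])
  qed
  then show ?thesis
    using vector_eq_rdot by blast
qed

section \<open>Rules for partial derivatives\<close>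

lemma partial_deriv_eq:
  assumes "(f has_derivative f') (at x)"
  shows "partial_deriv k f x = f' (axis k 1)"
proof -
  have "((\<lambda>t. f (x + t *\<^sub>R axis k 1)) has_derivative (\<lambda>t. f' (t *\<^sub>R axis k 1))) (at 0)"
  proof (rule has_derivative_compose[where g = f and g' = f'])
    show "((\<lambda>t. x + t *\<^sub>R axis k 1) has_derivative (\<lambda>t. t *\<^sub>R axis k 1)) (at 0)"
      by (auto intro!: derivative_eq_intros)
  qed (use assms in simp)
  then have "((\<lambda>t. f (x + t *\<^sub>R axis k 1)) has_vector_derivative f' (axis k 1)) (at 0)"
    by (simp add: has_vector_derivative_def linear_cmul[OF has_derivative_linear[OF assms]])
  then show ?thesis
    unfolding partial_deriv_def by (rule vector_derivative_at)
qed

lemma partial_deriv_frechet: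
  assumes "f differentiable at x"
  shows "partial_deriv k f x = frechet_derivative f (at x) (axis k 1)"
  using assms by (intro partial_deriv_eq) (simp flip: frechet_derivative_works)

lemma partial_deriv_const: "partial_deriv k (\<lambda>x. c) x = 0"
  by (rule partial_deriv_eq[where f' = "\<lambda>_. 0"]) simp

lemma partial_deriv_add:
  assumes "f differentiable at x" "g differentiable at x"
  shows "partial_deriv k (\<lambda>y. f y + g y) x = partial_deriv k f x + partial_deriv k g x"
proof -
  obtain f' where f: "(f has_derivative f') (at x)"
    using assms(1) by (auto simp: differentiable_def)
  obtain g' where g: "(g has_derivative g') (at x)"
    using assms(2) by (auto simp: differentiable_def)
  show ?thesis
    by (simp add: partial_deriv_eq[OF has_derivative_add[OF f g]]
        partial_deriv_eq[OF f] partial_deriv_eq[OF g])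
qed

lemma partial_deriv_diff:
  assumes "f differentiable at x" "g differentiable at x"
  shows "partial_deriv k (\<lambda>y. f y - g y) x = partial_deriv k f x - partial_deriv k g x"
proof -
  obtain f' where f: "(f has_derivative f') (at x)"
    using assms(1) by (auto simp: differentiable_def)
  obtain g' where g: "(g has_derivative g') (at x)"
    using assms(2) by (auto simp: differentiable_def)
  show ?thesis
    by (simp add: partial_deriv_eq[OF has_derivative_diff[OF f g]]
        partial_deriv_eq[OF f] partial_deriv_eq[OF g])
qed

text \<open>
  The assumption is a bounded quantifier rather than a rule, because then composing it with
  an equation between function values unifies without spurious higher-order solutions.
\<close>
lemma partial_deriv_cong_open:
  assumes "open U" "x \<in> U" "\<forall>y\<in>U. f y = g y"
  shows "partial_deriv k f x = partial_deriv k g x"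
proof -
  have "((\<lambda>t. x + t *\<^sub>R axis k 1) \<longlongrightarrow> x + 0 *\<^sub>R axis k 1) (nhds (0::real))"
    by (intro tendsto_intros filterlim_ident)
  then have "((\<lambda>t. x + t *\<^sub>R axis k 1) \<longlongrightarrow> x) (nhds (0::real))"
    by simp
  then have "\<forall>\<^sub>F t in nhds (0::real). x + t *\<^sub>R axis k 1 \<in> U"
    using assms(1,2) by (rule topological_tendstoD)
  then have "\<forall>\<^sub>F t in nhds (0::real). f (x + t *\<^sub>R axis k 1) = g (x + t *\<^sub>R axis k 1)"
    by eventually_elim (use assms(3) in simp)
  then show ?thesis
    unfolding partial_deriv_def
    by (intro vector_derivative_cong_eq) auto
qed

lemma differentiable_transform_open:
  assumes "f differentiable at x" "open U" "x \<in> U" "\<forall>y\<in>U. f y = g y"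
  shows "g differentiable at x"
proof -
  obtain f' where "(f has_derivative f') (at x)"
    using assms(1) by (auto simp: differentiable_def)
  from has_derivative_transform_within_open[OF this assms(2,3)] show ?thesis
    using assms(4) by (auto simp: differentiable_def)
qed

lemma partial_deriv_bilinear:
  assumes "bounded_bilinear op" "f differentiable at x" "g differentiable at x"
  shows "partial_deriv k (\<lambda>y. op (f y) (g y)) x
           = op (f x) (partial_deriv k g x) + op (partial_deriv k f x) (g x)"
proof -
  obtain f' where f: "(f has_derivative f') (at x)"
    using assms(2) by (auto simp: differentiable_def)
  obtain g' where g: "(g has_derivative g') (at x)"
    using assms(3) by (auto simp: differentiable_def)
  show ?thesis
    by (simp add: partial_deriv_eq[OF bounded_bilinear.FDERIV[OF assms(1) f g]]
        partial_deriv_eq[OF f] partial_deriv_eq[OF g])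
qed

lemmas partial_deriv_inner = partial_deriv_bilinear[OF bounded_bilinear_inner]
lemmas partial_deriv_mult = partial_deriv_bilinear[OF bounded_bilinear_mult]
lemmas partial_deriv_scaleR = partial_deriv_bilinear[OF bounded_bilinear_scaleR]

lemma differentiable_bilinear:
  assumes "bounded_bilinear op" "f differentiable at x" "g differentiable at x"
  shows "(\<lambda>y. op (f y) (g y)) differentiable at x"
  using assms(2,3) unfolding differentiable_def
  by (blast intro: bounded_bilinear.FDERIV[OF assms(1)])

lemma partial_deriv_commute:
  fixes f :: "real ^ 'n \<Rightarrow> 'b::real_inner"
  assumes "open U" "x \<in> U" "\<And>y. y \<in> U \<Longrightarrow> f differentiable at y"
    and "partial_deriv j f differentiable at x" "partial_deriv k f differentiable at x"
  shows "partial_deriv j (partial_deriv k f) x = partial_deriv k (partial_deriv j f) x"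
proof -
  let ?f' = "\<lambda>y. frechet_derivative f (at y)"
  have f': "(f has_derivative ?f' y) (at y)" if "y \<in> U" for y
    using assms(3)[OF that] by (simp flip: frechet_derivative_works)
  obtain J where J: "(partial_deriv j f has_derivative J) (at x)"
    using assms(4) by (auto simp: differentiable_def)
  obtain K where K: "(partial_deriv k f has_derivative K) (at x)"
    using assms(5) by (auto simp: differentiable_def)
  have "((\<lambda>y. ?f' y (axis j 1)) has_derivative J) (at x)"
    by (rule has_derivative_transform_within_open[OF J assms(1,2)])
       (simp add: partial_deriv_frechet assms(3))
  moreover have "((\<lambda>y. ?f' y (axis k 1)) has_derivative K) (at x)"
    by (rule has_derivative_transform_within_open[OF K assms(1,2)])
       (simp add: partial_deriv_frechet assms(3))
  ultimately have "J (axis k 1) = K (axis j 1)"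
    using mixed_derivatives_commute[OF assms(1,2) f'] by blast
  then show ?thesis
    by (simp add: partial_deriv_eq[OF J] partial_deriv_eq[OF K])
qed

lemma constant_if_partial_derivs_zero:
  fixes f :: "real ^ 'n \<Rightarrow> 'b::euclidean_space"
  assumes "open U" "connected U" "\<And>x. x \<in> U \<Longrightarrow> f differentiable at x"
    and "\<And>x k. x \<in> U \<Longrightarrow> partial_deriv k f x = 0"
  shows "\<exists>c. \<forall>x\<in>U. f x = c"
proof -
  have "(f has_derivative (\<lambda>_. 0)) (at x)" if x: "x \<in> U" for x
  proof -
    let ?f' = "frechet_derivative f (at x)"
    have f': "(f has_derivative ?f') (at x)"
      using assms(3)[OF x] by (simp flip: frechet_derivative_works)
    have "?f' = (\<lambda>_. 0)"
    proof (rule linear_eq_stdbasis)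
      fix b :: "real ^ 'n" assume "b \<in> Basis"
      then obtain k where "b = axis k 1" by (auto simp: Basis_vec_def)
      then show "?f' b = 0"
        using assms(4)[OF x] partial_deriv_eq[OF f'] by metis
    qed (use f' has_derivative_linear in \<open>auto intro: linear_zero\<close>)
    then show ?thesis using f' by simp
  qed
  then show ?thesis
    using has_derivative_zero_unique_connected[OF assms(1,2)] by blast
qed

section \<open>Differentiability classes\<close>

lemma C_k_on_cong_open:
  assumes "open S" "\<And>x. x \<in> S \<Longrightarrow> f x = g x" "C_k_on k S f"
  shows "C_k_on k S g"
  using assms(2,3)
proof (induction k arbitrary: f g)
  case 0
  then show ?case by (simp cong: continuous_on_cong)
next
  case (Suc k)
  have "f differentiable at x" if "x \<in> S" for x
    using Suc.prems(2) that by simp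
  then have "g differentiable at x" if "x \<in> S" for x
    using differentiable_transform_open[OF _ assms(1) that] Suc.prems(1) that by blast
  moreover have "C_k_on k S (\<lambda>x. frechet_derivative g (at x) v)" for v
  proof (rule Suc.IH)
    show "C_k_on k S (\<lambda>x. frechet_derivative f (at x) v)"
      using Suc.prems(2) by simp
    show "frechet_derivative f (at x) v = frechet_derivative g (at x) v" if "x \<in> S" for x
      using frechet_derivative_transform_within_open[of f x S g] Suc.prems that assms(1) by simp
  qed
  ultimately show ?case by simp
qed

lemma C_k_on_partial_deriv:
  assumes "open S" "C_k_on (Suc k) S f"
  shows "C_k_on k S (partial_deriv j f)"
proof (rule C_k_on_cong_open[OF assms(1)])
  show "C_k_on k S (\<lambda>x. frechet_derivative f (at x) (axis j 1))"
    using assms(2) by simp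
  show "frechet_derivative f (at x) (axis j 1) = partial_deriv j f x" if "x \<in> S" for x
    using assms(2) that by (simp add: partial_deriv_frechet)
qed

lemma smooth_on_partial_deriv:
  "open S \<Longrightarrow> smooth_on S f \<Longrightarrow> smooth_on S (partial_deriv j f)"
  unfolding smooth_on_def using C_k_on_partial_deriv by blast

lemma smooth_on_imp_differentiable:
  "smooth_on S f \<Longrightarrow> x \<in> S \<Longrightarrow> f differentiable at x"
  unfolding smooth_on_def by (metis C_k_on.simps(2))

lemma C_k_on_const: "C_k_on k S (\<lambda>x. c)"
  by (induction k arbitrary: c) auto

lemma has_derivative_affine:
  assumes "bounded_linear L"
  shows "((\<lambda>x. p + L x) has_derivative L) (at x)"
  using bounded_linear_imp_has_derivative[OF assms] by (auto intro!: derivative_eq_intros)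

lemma smooth_on_affine:
  assumes "bounded_linear L"
  shows "smooth_on S (\<lambda>x. p + L x)"
  unfolding smooth_on_def
proof
  fix k
  note L = has_derivative_affine[OF assms, of p]
  show "C_k_on k S (\<lambda>x. p + L x)"
  proof (cases k)
    case 0
    then show ?thesis
      by (simp add: continuous_on_add linear_continuous_on[OF assms])
  next
    case (Suc n)
    then show ?thesis
      using L C_k_on_const by (auto simp: differentiable_def simp flip: frechet_derivative_at[OF L])
  qed
qed

lemma harmonic_on_imp_differentiable:
  assumes "open U" "harmonic_on U E" "x \<in> U"
  shows "E differentiable at x" "partial_deriv k E differentiable at x"
proof -
  have *: "C_k_on (Suc (Suc 0)) U E"
    using assms(2) by (simp add: harmonic_on_def numeral_2_eq_2)
  then show "E differentiable at x" using assms(3) by simp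
  have "C_k_on (Suc 0) U (partial_deriv k E)"
    using C_k_on_partial_deriv[OF assms(1) *] .
  then show "partial_deriv k E differentiable at x" using assms(3) by simp
qed

section \<open>Harmonic functions whose squared gradient is a multiple of their cube\<close>

text \<open>
  Suppose \<open>c \<noteq> 0\<close> and write \<open>p = E_u\<close>, \<open>q = E_v\<close>, \<open>r = E_uu = - E_vv\<close>, \<open>s = E_uv\<close>. Differentiating
  \<open>p\<^sup>2 + q\<^sup>2 = c E\<^sup>3\<close> gives two linear equations for \<open>r\<close> and \<open>s\<close>, solved by
  \<open>2 E r = 3 (p\<^sup>2 - q\<^sup>2)\<close> and \<open>E s = 3 p q\<close>. The compatibility conditions \<open>r_v = s_u\<close> and
  \<open>s_v = - r_u\<close> then force \<open>p r + q s = 0 = p s - q r\<close>, so the gradient vanishes, which is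
  absurd. Conceptually, \<open>E_u - i E_v\<close> is holomorphic, so the logarithm of the squared gradient is harmonic
  where the gradient is nonzero; but it would be \<open>3 ln E\<close> up to a constant, whose Laplacian
  is \<open>- 3 (p\<^sup>2 + q\<^sup>2) / E\<^sup>2 < 0\<close>.
\<close>
lemma harmonic_cubic_gradient_imp_zero:
  fixes E :: "real ^ 2 \<Rightarrow> real"
  assumes U: "open U" "U \<noteq> {}"
    and harm: "harmonic_on U E"
    and pos: "\<And>x. x \<in> U \<Longrightarrow> E x > 0"
    and grad: "\<And>x. x \<in> U \<Longrightarrow> (partial_deriv 1 E x)\<^sup>2 + (partial_deriv 2 E x)\<^sup>2 = c * E x ^ 3"
  shows "c = 0"
proof (rule ccontr)
  assume c: "c \<noteq> 0"
  define p where "p = partial_deriv 1 E"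
  define q where "q = partial_deriv 2 E"
  define r where "r = partial_deriv 1 p"
  define s where "s = partial_deriv 2 p"
  have dE: "E differentiable at x" and dp: "p differentiable at x" and dq: "q differentiable at x"
    if "x \<in> U" for x
    using harmonic_on_imp_differentiable[OF U(1) harm that] by (auto simp: p_def q_def)
  have q_u: "\<forall>x\<in>U. partial_deriv 1 q x = s x"
    unfolding s_def q_def p_def using dE dp dq
    by (intro ballI partial_deriv_commute[OF U(1)]) (auto simp: p_def q_def)
  have q_v: "\<forall>x\<in>U. partial_deriv 2 q x = - r x"
    using harm by (auto simp: harmonic_on_def p_def q_def r_def)
  have grad': "\<forall>x\<in>U. p x * p x + q x * q x = c * (E x * (E x * E x))"
    using grad by (simp add: p_def q_def power2_eq_square power3_eq_cube mult.assoc)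
  note d_rules = partial_deriv_add partial_deriv_diff partial_deriv_mult partial_deriv_const
    differentiable_add differentiable_diff differentiable_mult differentiable_const
  have D: "p x * partial_deriv k p x + partial_deriv k p x * p x +
           (q x * partial_deriv k q x + partial_deriv k q x * q x)
         = c * (E x * (E x * partial_deriv k E x + partial_deriv k E x * E x)
                + partial_deriv k E x * (E x * E x))" if x: "x \<in> U" for x k
    using partial_deriv_cong_open[OF U(1) x grad', where k = k] dE[OF x] dp[OF x] dq[OF x]
    by (simp add: d_rules)
  have D1: "2 * (p x * r x + q x * s x) = 3 * c * (E x)\<^sup>2 * p x" if "x \<in> U" for x
    using D[OF that, of 1] q_u[rule_format, OF that]
    by (simp add: p_def[symmetric] r_def[symmetric] power2_eq_square algebra_simps)
  have D2: "2 * (p x * s x - q x * r x) = 3 * c * (E x)\<^sup>2 * q x" if "x \<in> U" for x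
    using D[OF that, of 2] q_v[rule_format, OF that]
    by (simp add: q_def[symmetric] s_def[symmetric] power2_eq_square algebra_simps)
  have R: "2 * E x * r x = 3 * (p x * p x - q x * q x)" if "x \<in> U" for x
  proof -
    have "(c * (E x)\<^sup>2) * (2 * E x * r x) = 2 * r x * (p x * p x + q x * q x)"
      unfolding grad'[rule_format, OF that] by (simp add: power2_eq_square)
    also have "\<dots> = p x * (2 * (p x * r x + q x * s x)) - q x * (2 * (p x * s x - q x * r x))"
      by (simp add: algebra_simps)
    also have "\<dots> = (c * (E x)\<^sup>2) * (3 * (p x * p x - q x * q x))"
      unfolding D1[OF that] D2[OF that] by (simp add: algebra_simps)
    finally show ?thesis using c pos[OF that] by simp
  qed
  have S: "\<forall>x\<in>U. E x * s x = 3 * (p x * q x)"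
  proof
    fix x assume that: "x \<in> U"
    have "(c * (E x)\<^sup>2) * (2 * (E x * s x)) = 2 * s x * (p x * p x + q x * q x)"
      unfolding grad'[rule_format, OF that] by (simp add: power2_eq_square)
    also have "\<dots> = q x * (2 * (p x * r x + q x * s x)) + p x * (2 * (p x * s x - q x * r x))"
      by (simp add: algebra_simps)
    also have "\<dots> = (c * (E x)\<^sup>2) * (2 * (3 * (p x * q x)))"
      unfolding D1[OF that] D2[OF that] by (simp add: algebra_simps)
    finally show "E x * s x = 3 * (p x * q x)" using c pos[OF that] by simp
  qed
  \<comment> \<open>As \<open>E\<close> is only twice continuously differentiable, \<open>r\<close> and \<open>s\<close> get their
      differentiability from these explicit formulas.\<close>
  have dr: "r differentiable at x" if x: "x \<in> U" for x
  proof -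
    have "(\<lambda>y. (3 * (p y * p y - q y * q y)) / (2 * E y)) differentiable at x"
      using dE[OF x] dp[OF x] dq[OF x] pos[OF x] by (auto intro!: derivative_intros)
    moreover have "r y = (3 * (p y * p y - q y * q y)) / (2 * E y)" if "y \<in> U" for y
      using R[OF that] pos[OF that] by (simp add: field_simps)
    ultimately show ?thesis
      using differentiable_transform_open[OF _ U(1) x] by fastforce
  qed
  have ds: "s differentiable at x" if x: "x \<in> U" for x
  proof -
    have "(\<lambda>y. (3 * (p y * q y)) / E y) differentiable at x"
      using dE[OF x] dp[OF x] dq[OF x] pos[OF x] by (auto intro!: derivative_intros)
    moreover have "s y = (3 * (p y * q y)) / E y" if "y \<in> U" for y
      using S[rule_format, OF that] pos[OF that] by (simp add: field_simps)
    ultimately show ?thesis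
      using differentiable_transform_open[OF _ U(1) x] by fastforce
  qed
  obtain x where x: "x \<in> U" using U(2) by blast
  have r_v: "partial_deriv 2 r x = partial_deriv 1 s x"
    unfolding r_def s_def using dp dr[OF x] ds[OF x] 
    by (intro partial_deriv_commute[OF U(1) x]) (auto simp: r_def s_def)
  have dq1: "partial_deriv 1 q differentiable at x"
    by (rule differentiable_transform_open[OF ds[OF x] U(1) x]) (simp add: q_u)
  have dq2: "partial_deriv 2 q differentiable at x"
    by (rule differentiable_transform_open[OF differentiable_minus[OF dr[OF x]] U(1) x]) (simp add: q_v)
  have "partial_deriv 2 s x = partial_deriv 2 (partial_deriv 1 q) x"
    using partial_deriv_cong_open[OF U(1) x q_u] by simp
  also have "\<dots> = partial_deriv 1 (partial_deriv 2 q) x"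
    using partial_deriv_commute[OF U(1) x dq dq2 dq1] .
  also have "\<dots> = partial_deriv 1 (\<lambda>y. - 1 * r y) x"
    by (rule partial_deriv_cong_open[OF U(1) x]) (simp add: q_v)
  also have "\<dots> = - partial_deriv 1 r x"
    using dr[OF x] by (simp only: d_rules)
  finally have s_v: "partial_deriv 2 s x = - partial_deriv 1 r x" .
  have R': "\<forall>x\<in>U. E x * r x + E x * r x = 3 * (p x * p x - q x * q x)"
    using R by (simp add: algebra_simps)
  have DR: "E x * partial_deriv k r x + partial_deriv k E x * r x +
         (E x * partial_deriv k r x + partial_deriv k E x * r x)
      = 3 * (p x * partial_deriv k p x + partial_deriv k p x * p x -
             (q x * partial_deriv k q x + partial_deriv k q x * q x))" for k
    using partial_deriv_cong_open[OF U(1) x R', where k = k] dE[OF x] dp[OF x] dq[OF x] dr[OF x]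
    by (simp add: d_rules mult.commute)
  have DS: "E x * partial_deriv k s x + partial_deriv k E x * s x
      = 3 * (p x * partial_deriv k q x + partial_deriv k p x * q x)" for k
    using partial_deriv_cong_open[OF U(1) x S, where k = k] dE[OF x] dp[OF x] dq[OF x] ds[OF x]
    by (simp add: d_rules)
  have "p x * r x + q x * s x = 0"
    using DR[of 1] DS[of 2] q_u[rule_format, OF x] q_v[rule_format, OF x] s_v
    by (simp add: p_def[symmetric] q_def[symmetric] r_def[symmetric] s_def[symmetric] algebra_simps)
  moreover have "p x * s x - q x * r x = 0"
    using DR[of 2] DS[of 1] q_u[rule_format, OF x] q_v[rule_format, OF x] r_v
    by (simp add: p_def[symmetric] q_def[symmetric] r_def[symmetric] s_def[symmetric] algebra_simps)
  ultimately have "p x = 0" "q x = 0"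
    using D1[OF x] D2[OF x] c pos[OF x] by auto
  then show False
    using grad'[rule_format, OF x] c pos[OF x] by simp
qed

section \<open>Umbilic surfaces in isothermal coordinates\<close>

text \<open>
  The difference \<open>Y\<close> of the two sides is orthogonal to \<open>a\<close> and \<open>b\<close>, hence has zero
  cross product with \<open>a \<times> b\<close>, and it is also orthogonal to \<open>a \<times> b \<noteq> 0\<close>; so \<open>Y = 0\<close>.
\<close>
lemma frame_expansion:
  fixes a b n X :: "real ^ 3"
  assumes "a \<bullet> a = E" "b \<bullet> b = E" "a \<bullet> b = 0" "E > 0" and n: "n = cross3 a b /\<^sub>R E"
  shows "X = (X \<bullet> a / E) *\<^sub>R a + (X \<bullet> b / E) *\<^sub>R b + (X \<bullet> n) *\<^sub>R n"
proof -
  define Y where "Y = X - ((X \<bullet> a / E) *\<^sub>R a + (X \<bullet> b / E) *\<^sub>R b + (X \<bullet> n) *\<^sub>R n)"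
  have na: "n \<bullet> a = 0" "n \<bullet> b = 0"
    by (simp_all add: n dot_cross_self inner_commute)
  have nn: "n \<bullet> n = 1"
    using assms by (simp add: dot_cross inner_commute[of b a] field_simps)
  have Ya: "Y \<bullet> a = 0" and Yb: "Y \<bullet> b = 0" and Yn: "Y \<bullet> n = 0"
    using assms(1-4) na nn
    by (simp_all add: Y_def inner_diff_left inner_add_left inner_commute[of b a]
          inner_commute[of a n] inner_commute[of b n])
  have "Y \<bullet> cross3 a b = 0"
    using Yn \<open>E > 0\<close> by (simp add: n)
  moreover have "cross3 Y (cross3 a b) = 0"
    using Ya Yb by (simp add: Lagrange)
  moreover have "cross3 a b \<noteq> 0"
    using nn n by auto
  ultimately have "Y = 0"
    using norm_and_cross_eq_0[of Y "cross3 a b"] by auto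
  then show ?thesis by (simp add: Y_def)
qed

locale umbilic_isothermal =
  fixes U :: "(real ^ 2) set" and i :: "real ^ 2 \<Rightarrow> real ^ 3" and E e :: "real ^ 2 \<Rightarrow> real"
  assumes U: "open U" "connected U" "U \<noteq> {}"
    and smooth: "smooth_on U i"
    and first: "\<And>x j k. x \<in> U \<Longrightarrow> first_ff i x j k = E x * kronecker j k"
    and second: "\<And>x j k. x \<in> U \<Longrightarrow> second_ff i x j k = e x * kronecker j k"
    and pos: "\<And>x. x \<in> U \<Longrightarrow> E x > 0"
    and harm: "harmonic_on U E"
begin

text \<open>The moving frame: \<open>a\<close> and \<open>b\<close> are tangent, orthogonal and of squared length \<open>E\<close>.\<close>
definition "a = partial_deriv 1 i"
definition "b = partial_deriv 2 i"
definition "N = unit_normal i"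

lemma differentiable_frame:
  assumes "x \<in> U"
  shows "i differentiable at x" "a differentiable at x" "b differentiable at x"
    "partial_deriv k a differentiable at x" "partial_deriv k b differentiable at x"
    "E differentiable at x" "partial_deriv k E differentiable at x"
proof -
  have a: "smooth_on U a" and b: "smooth_on U b"
    unfolding a_def b_def by (rule smooth_on_partial_deriv[OF U(1) smooth])+
  note diff = smooth_on_imp_differentiable[OF _ assms]
  show "i differentiable at x" "a differentiable at x" "b differentiable at x"
    using diff smooth a b by blast+
  show "partial_deriv k a differentiable at x" "partial_deriv k b differentiable at x"
    by (rule diff[OF smooth_on_partial_deriv[OF U(1) a]])
       (rule diff[OF smooth_on_partial_deriv[OF U(1) b]])
  show "E differentiable at x" "partial_deriv k E differentiable at x"
    by (rule harmonic_on_imp_differentiable[OF U(1) harm assms])+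
qed

lemma frame_inner:
  assumes "x \<in> U"
  shows "a x \<bullet> a x = E x" "b x \<bullet> b x = E x" "a x \<bullet> b x = 0" "b x \<bullet> a x = 0"
  using first[OF assms, of 1 1] first[OF assms, of 2 2] first[OF assms, of 1 2]
  by (auto simp: first_ff_def kronecker_def a_def b_def inner_commute)

lemma second_ff_frame:
  assumes "x \<in> U"
  shows "partial_deriv 1 a x \<bullet> N x = e x" "partial_deriv 2 a x \<bullet> N x = 0"
    "partial_deriv 1 b x \<bullet> N x = 0" "partial_deriv 2 b x \<bullet> N x = e x"
  using second[OF assms, of 1 1] second[OF assms, of 1 2]
    second[OF assms, of 2 1] second[OF assms, of 2 2]
  by (auto simp: second_ff_def kronecker_def a_def b_def N_def)

text \<open>
  In isothermal coordinates the area element is \<open>E\<close> itself; this makes the normal a quotient of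
  differentiable functions, with no norm to differentiate.
\<close>
lemma normal_eq:
  assumes "x \<in> U"
  shows "N x = cross3 (a x) (b x) /\<^sub>R E x"
proof -
  have "(norm (cross3 (a x) (b x)))\<^sup>2 = (E x)\<^sup>2"
    using frame_inner[OF assms] by (simp add: power2_norm_eq_inner dot_cross) (simp add: power2_eq_square)
  then have "norm (cross3 (a x) (b x)) = E x"
    using pos[OF assms] by (simp add: power2_eq_iff_nonneg)
  then show ?thesis
    by (simp add: N_def unit_normal_def a_def b_def)
qed

lemma normal_frame:
  assumes "x \<in> U"
  shows "N x \<bullet> a x = 0" "N x \<bullet> b x = 0" "N x \<bullet> N x = 1"
proof -
  show "N x \<bullet> a x = 0" "N x \<bullet> b x = 0"
    by (simp_all add: normal_eq[OF assms] dot_cross_self)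
  show "N x \<bullet> N x = 1"
    using pos[OF assms] frame_inner[OF assms]
    by (simp add: normal_eq[OF assms] dot_cross field_simps)
qed

lemma frame_expansion_at:
  assumes "x \<in> U"
  shows "X = (X \<bullet> a x / E x) *\<^sub>R a x + (X \<bullet> b x / E x) *\<^sub>R b x + (X \<bullet> N x) *\<^sub>R N x"
  by (rule frame_expansion) (use frame_inner normal_eq pos assms in auto)

lemma differentiable_normal:
  assumes "x \<in> U"
  shows "N differentiable at x"
proof -
  have "(\<lambda>y. cross3 (a y) (b y)) differentiable at x"
    using bilinear_cross differentiable_frame(2,3)[OF assms]
    by (simp add: differentiable_bilinear[where op = cross3] bilinear_conv_bounded_bilinear)
  moreover have "(\<lambda>y. inverse (E y)) differentiable at x"
    using differentiable_frame(6)[OF assms] pos[OF assms] by (intro differentiable_inverse) auto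
  ultimately have "(\<lambda>y. cross3 (a y) (b y) /\<^sub>R E y) differentiable at x"
    by (rule differentiable_bilinear[OF bounded_bilinear_scaleR, rotated])
  then show ?thesis
    by (rule differentiable_transform_open[OF _ U(1) assms]) (simp add: normal_eq)
qed

lemma partial_deriv_inner_const:
  assumes "x \<in> U" "\<forall>y\<in>U. f y \<bullet> g y = c" "f differentiable at x" "g differentiable at x"
  shows "partial_deriv k f x \<bullet> g x = - (f x \<bullet> partial_deriv k g x)"
proof -
  have "partial_deriv k (\<lambda>y. f y \<bullet> g y) x = partial_deriv k (\<lambda>_. c) x"
    by (rule partial_deriv_cong_open[OF U(1) assms(1)]) (use assms(2) in auto)
  then show ?thesis
    using partial_deriv_inner[OF assms(3,4), of k] by (simp add: partial_deriv_const)
qed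

text \<open>The principal curvature: at an umbilic point both principal curvatures are equal.\<close>
definition "H x = e x / E x"

text \<open>
  Differentiating the orthogonality relations of the frame moves the derivative from the normal to the tangent
  vectors, where the second fundamental form gives its components.
\<close>
lemma weingarten:
  assumes "x \<in> U"
  shows "partial_deriv 1 N x = - H x *\<^sub>R a x" "partial_deriv 2 N x = - H x *\<^sub>R b x"
proof -
  have NN: "partial_deriv k N x \<bullet> N x = 0" for k
    using partial_deriv_inner_const[of x N N 1 k] assms normal_frame(3) differentiable_normal[OF assms]
    by (simp add: inner_commute)
  have Na: "partial_deriv k N x \<bullet> a x = - (partial_deriv k a x \<bullet> N x)" for k
    using partial_deriv_inner_const[of x N a 0 k] assms normal_frame(1) differentiable_normal[OF assms]
      differentiable_frame[OF assms] by (simp add: inner_commute)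
  have Nb: "partial_deriv k N x \<bullet> b x = - (partial_deriv k b x \<bullet> N x)" for k
    using partial_deriv_inner_const[of x N b 0 k] assms normal_frame(2) differentiable_normal[OF assms]
      differentiable_frame[OF assms] by (simp add: inner_commute)
  show "partial_deriv 1 N x = - H x *\<^sub>R a x"
    using frame_expansion_at[OF assms, of "partial_deriv 1 N x"] second_ff_frame[OF assms] NN[of 1] Na[of 1] Nb[of 1]
    by (simp add: H_def)
  show "partial_deriv 2 N x = - H x *\<^sub>R b x"
    using frame_expansion_at[OF assms, of "partial_deriv 2 N x"] second_ff_frame[OF assms] NN[of 2] Na[of 2] Nb[of 2]
    by (simp add: H_def)
qed

lemma mixed_partials:
  assumes "x \<in> U"
  shows "partial_deriv 2 a x = partial_deriv 1 b x"
  unfolding a_def b_def using differentiable_frame assms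
  by (intro partial_deriv_commute[OF U(1)]) (auto simp: a_def b_def)

lemma differentiable_H:
  assumes "x \<in> U"
  shows "H differentiable at x"
proof -
  have "(\<lambda>y. partial_deriv 1 a y \<bullet> N y / E y) differentiable at x"
    using differentiable_frame[OF assms] differentiable_normal[OF assms] pos[OF assms]
    by (simp add: differentiable_divide differentiable_bilinear[OF bounded_bilinear_inner])
  then show ?thesis
    by (rule differentiable_transform_open[OF _ U(1) assms]) (simp add: H_def second_ff_frame)
qed

text \<open>
  Equality of the mixed derivatives of the normal reads \<open>H_v a = H_u b\<close>, as the terms
  \<open>H a_v\<close> and \<open>H b_u\<close> cancel; \<open>a\<close> and \<open>b\<close> are linearly independent.
\<close>
lemma H_constant: "\<exists>h. \<forall>x\<in>U. H x = h"
proof (rule constant_if_partial_derivs_zero[OF U(1,2) differentiable_H])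
  fix x k assume x: "x \<in> U"
  note dH = differentiable_H[OF x]
  have 1: "\<forall>y\<in>U. partial_deriv 1 N y = (- 1 * H y) *\<^sub>R a y"
    and 2: "\<forall>y\<in>U. partial_deriv 2 N y = (- 1 * H y) *\<^sub>R b y"
    using weingarten by auto
  have dH': "(\<lambda>y. - 1 * H y) differentiable at x"
    using dH by simp
  have pH: "partial_deriv k (\<lambda>y. - 1 * H y) x = - partial_deriv k H x" for k
    using dH by (subst partial_deriv_mult) (auto simp: partial_deriv_const)
  have d1: "partial_deriv 1 N differentiable at x"
    by (rule differentiable_transform_open[OF
          differentiable_bilinear[OF bounded_bilinear_scaleR dH' differentiable_frame(2)[OF x]] U(1) x])
       (simp add: 1)
  have d2: "partial_deriv 2 N differentiable at x"
    by (rule differentiable_transform_open[OF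
          differentiable_bilinear[OF bounded_bilinear_scaleR dH' differentiable_frame(3)[OF x]] U(1) x])
       (simp add: 2)
  have "partial_deriv 2 (partial_deriv 1 N) x = partial_deriv 1 (partial_deriv 2 N) x"
    by (rule partial_deriv_commute[OF U(1) x differentiable_normal d2 d1])
  moreover have "partial_deriv 2 (partial_deriv 1 N) x
      = - H x *\<^sub>R partial_deriv 2 a x - partial_deriv 2 H x *\<^sub>R a x"
    using partial_deriv_cong_open[OF U(1) x 1, where k = 2]
      partial_deriv_scaleR[OF dH' differentiable_frame(2)[OF x], of 2] by (simp add: pH[simplified])
  moreover have "partial_deriv 1 (partial_deriv 2 N) x
      = - H x *\<^sub>R partial_deriv 1 b x - partial_deriv 1 H x *\<^sub>R b x"
    using partial_deriv_cong_open[OF U(1) x 2, where k = 1]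
      partial_deriv_scaleR[OF dH' differentiable_frame(3)[OF x], of 1] by (simp add: pH[simplified])
  ultimately have eq: "partial_deriv 2 H x *\<^sub>R a x = partial_deriv 1 H x *\<^sub>R b x"
    using mixed_partials[OF x] by simp
  have "partial_deriv 2 H x = 0"
    using arg_cong[OF eq, of "\<lambda>v. v \<bullet> a x"] frame_inner[OF x] pos[OF x] by (simp add: inner_commute)
  moreover have "partial_deriv 1 H x = 0"
    using arg_cong[OF eq, of "\<lambda>v. v \<bullet> b x"] frame_inner[OF x] pos[OF x] by simp
  ultimately show "partial_deriv k H x = 0"
    using exhaust_2[of k] by auto
qed

text \<open>
  These are the tangential components of the second derivatives of the immersion, that is, its Christoffel symbols
  lowered with the first fundamental form.
\<close>
lemma christoffel:
  assumes x: "x \<in> U"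
  shows "partial_deriv k a x \<bullet> a x = partial_deriv k E x / 2"
    "partial_deriv k b x \<bullet> b x = partial_deriv k E x / 2"
    "partial_deriv k a x \<bullet> b x = - (partial_deriv k b x \<bullet> a x)"
proof -
  note d = differentiable_frame[OF x]
  have aa: "\<forall>y\<in>U. a y \<bullet> a y = E y" and bb: "\<forall>y\<in>U. b y \<bullet> b y = E y"
    using frame_inner by blast+
  show "partial_deriv k a x \<bullet> a x = partial_deriv k E x / 2"
    using partial_deriv_cong_open[OF U(1) x aa, where k = k] partial_deriv_inner[OF d(2) d(2), of k]
    by (simp add: inner_commute)
  show "partial_deriv k b x \<bullet> b x = partial_deriv k E x / 2"
    using partial_deriv_cong_open[OF U(1) x bb, where k = k] partial_deriv_inner[OF d(3) d(3), of k]
    by (simp add: inner_commute)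
  show "partial_deriv k a x \<bullet> b x = - (partial_deriv k b x \<bullet> a x)"
    using partial_deriv_inner_const[OF x _ d(2,3), of 0 k] frame_inner(3) by (simp add: inner_commute)
qed

text \<open>
  This is the Gauss equation. In general the difference of the two sides is
  \<open>- (E_uu + E_vv) / 2\<close>, obtained by differentiating \<open>a_u \<bullet> b = - E_v / 2\<close> by \<open>v\<close> and
  \<open>a_v \<bullet> b = E_u / 2\<close> by \<open>u\<close>; harmonicity of \<open>E\<close> makes it vanish.
\<close>
lemma gauss:
  assumes x: "x \<in> U"
  shows "partial_deriv 1 a x \<bullet> partial_deriv 2 b x = partial_deriv 2 a x \<bullet> partial_deriv 2 a x"
proof -
  note d = differentiable_frame[OF x]
  have 1: "\<forall>y\<in>U. partial_deriv 1 a y \<bullet> b y = (- 1 / 2) * partial_deriv 2 E y"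
    using christoffel(1,3) by (auto simp flip: mixed_partials)
  have 2: "\<forall>y\<in>U. partial_deriv 2 a y \<bullet> b y = (1 / 2) * partial_deriv 1 E y"
    using christoffel mixed_partials by simp
  have half: "partial_deriv k (\<lambda>y. c * partial_deriv l E y) x = c * partial_deriv k (partial_deriv l E) x"
    for k l c
    using d(7) by (simp add: partial_deriv_mult partial_deriv_const)
  have "partial_deriv 1 a x \<bullet> partial_deriv 2 b x + partial_deriv 2 (partial_deriv 1 a) x \<bullet> b x
      = (- 1 / 2) * partial_deriv 2 (partial_deriv 2 E) x"
    using partial_deriv_cong_open[OF U(1) x 1, where k = 2] partial_deriv_inner[OF d(4) d(3), of 2 1]
    unfolding half by simp
  moreover have "partial_deriv 2 a x \<bullet> partial_deriv 1 b x + partial_deriv 1 (partial_deriv 2 a) x \<bullet> b x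
      = (1 / 2) * partial_deriv 1 (partial_deriv 1 E) x"
    using partial_deriv_cong_open[OF U(1) x 2, where k = 1] partial_deriv_inner[OF d(4) d(3), of 1 2]
    unfolding half by simp
  moreover have "partial_deriv 1 (partial_deriv 2 a) x = partial_deriv 2 (partial_deriv 1 a) x"
    using differentiable_frame by (intro partial_deriv_commute[OF U(1) x]) (use x in auto)
  moreover have "partial_deriv 1 (partial_deriv 1 E) x + partial_deriv 2 (partial_deriv 2 E) x = 0"
    using harm x by (simp add: harmonic_on_def)
  ultimately show ?thesis
    using mixed_partials[OF x] by simp
qed

text \<open>
  The Gauss equation written out in the frame. It says that the Gauss curvature \<open>H\<^sup>2\<close> equals
  \<open>- (ln E)_uu / (2 E) - (ln E)_vv / (2 E)\<close>, which for harmonic \<open>E\<close> is the squared gradient of \<open>E\<close>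
  divided by \<open>2 E\<^sup>3\<close>.
\<close>
lemma gradient_eq:
  assumes x: "x \<in> U"
  shows "(partial_deriv 1 E x)\<^sup>2 + (partial_deriv 2 E x)\<^sup>2 = 2 * (H x)\<^sup>2 * E x ^ 3"
proof -
  have parseval: "X \<bullet> Y = (X \<bullet> a x) * (Y \<bullet> a x) / E x + (X \<bullet> b x) * (Y \<bullet> b x) / E x
      + (X \<bullet> N x) * (Y \<bullet> N x)" for X Y
    using arg_cong[OF frame_expansion_at[OF x, of X], of "\<lambda>Z. Z \<bullet> Y"]
    by (simp add: inner_add_left inner_commute[of "a x" Y] inner_commute[of "b x" Y]
        inner_commute[of "N x" Y])
  let ?p = "partial_deriv 1 E x" and ?q = "partial_deriv 2 E x"
  have 1: "partial_deriv 1 a x \<bullet> b x = - ?q / 2" "partial_deriv 2 a x \<bullet> b x = ?p / 2"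
     "partial_deriv 2 b x \<bullet> a x = - ?p / 2"
    using christoffel(1)[OF x, of 2] christoffel(2)[OF x, of 1]
      christoffel(3)[OF x, of 1] christoffel(3)[OF x, of 2] mixed_partials[OF x] by simp_all
  have "(?p / 2) * (- ?p / 2) / E x + (- ?q / 2) * (?q / 2) / E x + e x * e x
      = (?q / 2) * (?q / 2) / E x + (?p / 2) * (?p / 2) / E x"
    using gauss[OF x] parseval[of "partial_deriv 1 a x" "partial_deriv 2 b x"]
      parseval[of "partial_deriv 2 a x" "partial_deriv 2 a x"]
    by (simp add: 1 christoffel(1,2)[OF x] second_ff_frame[OF x])
  then have "?p\<^sup>2 + ?q\<^sup>2 = 2 * E x * (e x)\<^sup>2"
    using pos[OF x] by (simp add: field_simps power2_eq_square)
  then show ?thesis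
    using pos[OF x] by (simp add: H_def power2_eq_square power3_eq_cube)
qed

lemma H_zero:
  assumes "x \<in> U"
  shows "H x = 0"
proof -
  obtain h where h: "\<And>y. y \<in> U \<Longrightarrow> H y = h"
    using H_constant by blast
  have "2 * h\<^sup>2 = 0"
    by (rule harmonic_cubic_gradient_imp_zero[OF U(1,3) harm pos])
       (use gradient_eq h in auto)
  then show ?thesis
    using h[OF assms] by simp
qed

text \<open>
  With \<open>H = 0\<close> the normal is a constant vector, and its inner product with the immersion has zero
  derivative because the tangent vectors are orthogonal to it.
\<close>
lemma planar: "\<exists>P. affine_plane P \<and> i ` U \<subseteq> P"
proof -
  have "partial_deriv k N x = 0" if "x \<in> U" for x k
    using exhaust_2[of k] weingarten[OF that] H_zero[OF that] by auto
  then obtain n where n: "\<And>x. x \<in> U \<Longrightarrow> N x = n"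
    using constant_if_partial_derivs_zero[OF U(1,2) differentiable_normal] by blast
  have "n \<noteq> 0"
    using U(3) n normal_frame(3) by force
  have dn: "(\<lambda>y. n \<bullet> i y) differentiable at x" if "x \<in> U" for x
    using differentiable_frame(1)[OF that] by (intro differentiable_bilinear[OF bounded_bilinear_inner]) auto
  have "partial_deriv k (\<lambda>y. n \<bullet> i y) x = 0" if "x \<in> U" for x k
    using exhaust_2[of k] n[OF that] normal_frame[OF that] differentiable_frame(1)[OF that]
    by (auto simp: partial_deriv_inner partial_deriv_const a_def b_def)
  then obtain c where "\<And>x. x \<in> U \<Longrightarrow> n \<bullet> i x = c"
    using constant_if_partial_derivs_zero[OF U(1,2) dn] by blast
  then have "i ` U \<subseteq> {y. n \<bullet> y = c}" by auto
  moreover have "affine_plane {y. n \<bullet> y = c}"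
    using \<open>n \<noteq> 0\<close> by (simp add: affine_plane_def affine_hyperplane aff_dim_hyperplane)
  ultimately show ?thesis by blast
qed

end

section \<open>Affine planes\<close>

lemma affine_plane_orthonormal_param:
  assumes "affine_plane P"
  obtains p v w where "norm v = 1" "norm w = 1" "v \<bullet> w = 0"
    "P = range (\<lambda>x :: real ^ 2. p + (x $ 1 *\<^sub>R v + x $ 2 *\<^sub>R w))"
proof -
  have P: "affine P" "aff_dim P = 2" using assms by (auto simp: affine_plane_def)
  then obtain p where p: "p \<in> P"
    by fastforce
  define S where "S = (\<lambda>y. - p + y) ` P"
  have S: "subspace S"
    unfolding S_def by (rule affine_diffs_subspace[OF P(1) p])
  have "aff_dim S = 2"
    unfolding S_def using P(2) by (simp only: aff_dim_translation_eq)
  then have "dim S = 2"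
    using aff_dim_subspace[OF S] by simp
  then obtain B where B: "B \<subseteq> S" "pairwise orthogonal B" "\<And>y. y \<in> B \<Longrightarrow> norm y = 1"
    "card B = 2" "span B = S"
    using orthonormal_basis_subspace[OF S] by metis
  obtain v w where vw: "B = {v, w}" "v \<noteq> w"
    using B(4) by (auto simp: card_2_iff)
  have "P = (+) p ` S"
    by (simp add: S_def image_image)
  also have "S = range (\<lambda>x :: real ^ 2. x $ 1 *\<^sub>R v + x $ 2 *\<^sub>R w)"
  proof -
    have "\<exists>x :: real ^ 2. s *\<^sub>R v + t *\<^sub>R w = x $ 1 *\<^sub>R v + x $ 2 *\<^sub>R w" for s t
      by (rule exI[of _ "vector [s, t]"]) simp
    moreover have "S = {y. \<exists>s t. y = s *\<^sub>R v + t *\<^sub>R w}"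
      unfolding B(5)[symmetric] vw
      by (auto simp: span_insert span_singleton algebra_simps)
    ultimately show ?thesis by fastforce
  qed
  finally have "P = range (\<lambda>x :: real ^ 2. p + (x $ 1 *\<^sub>R v + x $ 2 *\<^sub>R w))"
    by (simp add: image_image)
  then show ?thesis
    using that[of v w p] B vw by (auto simp: pairwise_insert orthogonal_def)
qed

lemma orthonormal_param_flat:
  fixes v w p :: "real ^ 3"
  assumes vw: "norm v = 1" "norm w = 1" "v \<bullet> w = 0"
  defines "i \<equiv> \<lambda>x :: real ^ 2. p + (x $ 1 *\<^sub>R v + x $ 2 *\<^sub>R w)"
  shows "smooth_immersion_on UNIV i" "first_ff i x j k = 1 * kronecker j k"
    "second_ff i x j k = 0 * kronecker j k"
proof -
  define L where "L = (\<lambda>x :: real ^ 2. x $ 1 *\<^sub>R v + x $ 2 *\<^sub>R w)"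
  have L: "bounded_linear L"
    unfolding L_def
    by (intro bounded_linear_add bounded_linear_compose[OF bounded_linear_scaleR_left] bounded_linear_vec_nth)
  have i': "(i has_derivative L) (at x)" for x
    using has_derivative_affine[OF L] by (simp add: i_def L_def)
  have "inj L"
  proof (rule injI)
    fix x y assume eq: "L x = L y"
    have "x $ 1 = y $ 1"
      using arg_cong[OF eq, of "\<lambda>z. z \<bullet> v"] vw by (simp add: L_def inner_add_left inner_commute[of w v] dot_square_norm)
    moreover have "x $ 2 = y $ 2"
      using arg_cong[OF eq, of "\<lambda>z. z \<bullet> w"] vw by (simp add: L_def inner_add_left dot_square_norm)
    ultimately show "x = y" by (simp add: vec_eq_iff forall_2)
  qed
  then show "smooth_immersion_on UNIV i"
    using smooth_on_affine[OF L, of UNIV p] frechet_derivative_at[OF i', symmetric]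
    by (simp add: smooth_immersion_on_def) (simp add: i_def L_def)
  have pi: "partial_deriv k i = (\<lambda>x. L (axis k 1))" for k
    using partial_deriv_eq[OF i'] by blast
  have Lvw: "L (axis 1 1) = v" "L (axis 2 1) = w"
    by (auto simp: L_def axis_def)
  have "w \<bullet> v = 0"
    using vw(3) by (simp add: inner_commute)
  then show "first_ff i x j k = 1 * kronecker j k"
    using exhaust_2[of j] exhaust_2[of k] vw
    by (auto simp: first_ff_def pi Lvw kronecker_def dot_square_norm)
  show "second_ff i x j k = 0 * kronecker j k"
    by (simp add: second_ff_def pi partial_deriv_const)
qed

lemma harmonic_on_const: "harmonic_on S (\<lambda>x. c)"
proof -
  have "partial_deriv k (\<lambda>x. c) = (\<lambda>x. 0)" for k :: 2 and c :: real
    using partial_deriv_const by blast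
  then show ?thesis
    by (simp add: harmonic_on_def C_k_on_const)
qed

section \<open>The characterization of planes\<close>

theorem mainTheorem1:
  shows
    "(\<forall>(U :: (real ^ 2) set) (i :: real ^ 2 \<Rightarrow> real ^ 3) (E :: real ^ 2 \<Rightarrow> real) (e :: real ^ 2 \<Rightarrow> real).
        U \<noteq> {} \<longrightarrow> open U \<longrightarrow> connected U \<longrightarrow>
        smooth_immersion_on U i \<longrightarrow>
        (\<forall>x\<in>U. \<forall>j k. first_ff i x j k = E x * kronecker j k) \<longrightarrow>
        (\<forall>x\<in>U. E x > 0) \<longrightarrow>
        harmonic_on U E \<longrightarrow>
        (\<forall>x\<in>U. \<forall>j k. second_ff i x j k = e x * kronecker j k) \<longrightarrow>
        (\<exists>P. affine_plane P \<and> i ` U \<subseteq> P))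
     \<and>
     (\<forall>P :: (real ^ 3) set. affine_plane P \<longrightarrow>
        (\<exists>(i :: real ^ 2 \<Rightarrow> real ^ 3) (E :: real ^ 2 \<Rightarrow> real) (e :: real ^ 2 \<Rightarrow> real).
           smooth_immersion_on UNIV i \<and>
           range i = P \<and>
           (\<forall>x j k. first_ff i x j k = E x * kronecker j k) \<and>
           (\<forall>x. E x > 0) \<and>
           harmonic_on UNIV E \<and>
           (\<forall>x j k. second_ff i x j k = e x * kronecker j k)))"
proof (intro conjI allI impI)
  fix U :: "(real ^ 2) set" and i :: "real ^ 2 \<Rightarrow> real ^ 3" and E e :: "real ^ 2 \<Rightarrow> real"
  assume "U \<noteq> {}" "open U" "connected U" "smooth_immersion_on U i"
    "\<forall>x\<in>U. \<forall>j k. first_ff i x j k = E x * kronecker j k" "\<forall>x\<in>U. E x > 0"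
    "harmonic_on U E" "\<forall>x\<in>U. \<forall>j k. second_ff i x j k = e x * kronecker j k"
  then interpret umbilic_isothermal U i E e
    by unfold_locales (auto simp: smooth_immersion_on_def)
  show "\<exists>P. affine_plane P \<and> i ` U \<subseteq> P"
    by (rule planar)
next
  fix P :: "(real ^ 3) set" assume "affine_plane P"
  then obtain p v w where vw: "norm v = 1" "norm w = 1" "v \<bullet> w = 0"
    and P: "P = range (\<lambda>x :: real ^ 2. p + (x $ 1 *\<^sub>R v + x $ 2 *\<^sub>R w))"
    by (rule affine_plane_orthonormal_param)
  show "\<exists>(i :: real ^ 2 \<Rightarrow> real ^ 3) (E :: real ^ 2 \<Rightarrow> real) (e :: real ^ 2 \<Rightarrow> real).
           smooth_immersion_on UNIV i \<and>
           range i = P \<and>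
           (\<forall>x j k. first_ff i x j k = E x * kronecker j k) \<and>
           (\<forall>x. E x > 0) \<and>
           harmonic_on UNIV E \<and>
           (\<forall>x j k. second_ff i x j k = e x * kronecker j k)"
    by (rule exI[of _ "\<lambda>x. p + (x $ 1 *\<^sub>R v + x $ 2 *\<^sub>R w)"], rule exI[of _ "\<lambda>_. 1"],
        rule exI[of _ "\<lambda>_. 0"])
       (use orthonormal_param_flat[OF vw] P harmonic_on_const in auto)
qed

end
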